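(* For each $n\ge 1$ let $X_n$ and $Y_n$ be independent random variables, each following the uniform law on $\{1,\dots,n\}$. Let $Z_n=\gcd(X_n,Y_n)$ and $W_n=r(X_n)$, where for an integer $m\geq 1$, $r(m)$ denotes the largest integer $a$ such that $a^2$ divides $m$. Then, as $n\to+\infty$, both $W_n$ and $Z_n$ converge in law to the Zeta law of parameter $2$.
   Context: For $s>1$, the Zeta law of parameter $s$ is the probability on $\mathbb{N}^*=\{1,2,3,\dots\}$ assigning mass $\frac{n^{-s}}{\zeta(s)}$ to each point $n$, where $\zeta(s)=\sum_{k=1}^{+\infty}\frac{1}{k^s}$. For probabilities $P_n,P$ on a finite or countable set $\Omega$, $P_n$ converges in law to $P$ if $P_n(\{x\})\to P(\{x\})$ for every $x\in\Omega$ (equivalently $\sup_{A\subset\Omega}|P_n(A)-P(A)|\to 0$). A sequence of random variables converges in law to a probability if their laws do. *)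

theory Defs
  imports "HOL-Probability.Probability"
begin

definition zeta :: "real \<Rightarrow> real" where
  "zeta s = (\<Sum>k. 1 / real (Suc k) powr s)"

text \<open>Laws on the positive integers are carried by the type \<^typ>\<open>nat\<close>, with mass zero at 0.
  \<^const>\<open>embed_pmf\<close> is only meaningful for weights of total mass 1; for \<open>s > 1\<close> this is
  discharged in \<open>pmf_zeta_law\<close> below.\<close>

definition zeta_law :: "real \<Rightarrow> nat pmf" where
  "zeta_law s = embed_pmf (\<lambda>n. if n \<ge> 1 then real n powr (- s) / zeta s else 0)"

text \<open>Intended for probabilities on a countable set with all subsets measurable.\<close>

definition converges_in_law :: "(nat \<Rightarrow> 'a::countable measure) \<Rightarrow> 'a measure \<Rightarrow> bool" where
  "converges_in_law P Q \<longleftrightarrow> (\<forall>x. (\<lambda>n. measure (P n) {x}) \<longlonglongrightarrow> measure Q {x})"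

text \<open>The set is finite exactly when \<open>m \<ge> 1\<close>; the value at 0 is irrelevant.\<close>

definition largest_square_root_divisor :: "nat \<Rightarrow> nat" where
  "largest_square_root_divisor m = Max {a. a\<^sup>2 dvd m}"

lemma finite_square_divisors:
  assumes "m \<ge> 1"
  shows "finite {a::nat. a\<^sup>2 dvd m}"
proof (rule finite_subset)
  show "{a::nat. a\<^sup>2 dvd m} \<subseteq> {..m}"
  proof
    fix a :: nat assume "a \<in> {a. a\<^sup>2 dvd m}"
    then have "a dvd m" by (auto intro: dvd_trans[of a "a\<^sup>2"])
    then show "a \<in> {..m}" using assms by (auto dest: dvd_imp_le)
  qed
qed simp

lemma zeta_sums:
  assumes "s > 1"
  shows "(\<lambda>k. 1 / real (Suc k) powr s) sums zeta s"
proof -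
  have "summable (\<lambda>k. real k powr (- s))"
    using assms by (simp add: summable_real_powr_iff)
  then have "summable (\<lambda>k. real (Suc k) powr (- s))"
    by (subst summable_Suc_iff)
  then show ?thesis
    by (simp add: zeta_def summable_sums powr_minus_divide del: of_nat_Suc)
qed

lemma zeta_pos:
  assumes "s > 1"
  shows "zeta s > 0"
  unfolding zeta_def
  using sums_summable[OF zeta_sums[OF assms]] by (rule suminf_pos) simp

lemma pmf_zeta_law:
  assumes "s > 1"
  shows "pmf (zeta_law s) n = (if n \<ge> 1 then real n powr (- s) / zeta s else 0)"
proof -
  define f where "f = (\<lambda>n::nat. if n \<ge> 1 then real n powr (- s) / zeta s else 0)"
  have nn: "f n \<ge> 0" for n
    using zeta_pos[OF assms] by (simp add: f_def)
  have "(\<lambda>k. f (Suc k)) = (\<lambda>k. 1 / real (Suc k) powr s / zeta s)"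
    by (simp add: f_def powr_minus_divide del: of_nat_Suc)
  then have "(\<lambda>k. f (Suc k)) sums (zeta s / zeta s)"
    using sums_divide[OF zeta_sums[OF assms]] by metis
  then have "(\<lambda>k. f (Suc k)) sums 1"
    using zeta_pos[OF assms] by simp
  then have "f sums 1"
    using sums_Suc_iff[of f 1] by (simp add: f_def)
  then have "(\<integral>\<^sup>+n. ennreal (f n) \<partial>count_space UNIV) = 1"
    using suminf_ennreal_eq[OF nn \<open>f sums 1\<close>] by (simp add: nn_integral_count_space_nat)
  then have "pmf (embed_pmf f) n = f n"
    using nn by (intro pmf_embed_pmf)
  then show ?thesis
    by (simp add: zeta_law_def f_def)
qed

end

theory Submission
  imports Defs
begin

text \<open>
  The Zeta law of parameter 2 is determined, among laws \<open>Q\<close> on the positive integers, by the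
  probabilities of being divisible: \<open>Q(k\<nat>) = 1/k\<^sup>2\<close> for all \<open>k \<ge> 1\<close>. Both random variables
  have asymptotically this property, because \<open>k\<close> divides \<open>gcd x y\<close> iff it divides \<open>x\<close> and \<open>y\<close>,
  and \<open>k\<close> divides \<open>r(m)\<close> iff \<open>k\<^sup>2\<close> divides \<open>m\<close>. Since \<open>{1..n}\<close> contains \<open>n div d\<close>
  multiples of \<open>d\<close>, the probabilities are \<open>((n div k)/n)\<^sup>2\<close> and \<open>(n div k\<^sup>2)/n\<close>; both are at most
  \<open>1/k\<^sup>2\<close> and tend to it. The theorem therefore follows from one convergence criterion,
  \<open>converges_to_zeta_law_2\<close>.

  The criterion is proved without Moebius inversion or Euler products. Put
  \<open>c\<^sub>n(k) = k\<^sup>2 P\<^sub>n({k})\<close>, which lies in \<open>[0,1]\<close>. Splitting \<open>k\<nat>\<close> into the points \<open>k, 2k, 3k, \<dots>\<close> gives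
  \<open>c\<^sub>n(k) + (\<Sum>j\<ge>2. c\<^sub>n(jk)/j\<^sup>2) = k\<^sup>2 P\<^sub>n(k\<nat>) \<rightarrow> 1\<close>.
  The constant \<open>1/\<zeta>(2)\<close> solves the limiting equation, so the deviation
  \<open>e\<^sub>n(k) = \<bar>c\<^sub>n(k) - 1/\<zeta>(2)\<bar>\<close> satisfies
  \<open>limsup e\<^sub>n(k) \<le> (\<Sum>j\<ge>2. 1/j\<^sup>2) sup\<^sub>i limsup e\<^sub>n(i)\<close>.
  The factor is \<open>\<zeta>(2) - 1 = \<pi>\<^sup>2/6 - 1 < 1\<close>, and a uniform bound contracted by such a factor must vanish.
\<close>

section \<open>A contraction argument for dilated series\<close>

text \<open>
  A bound \<open>limsup e\<^sub>n(k) \<le> c\<close> is expressed as \<open>max c (e\<^sub>n(k)) \<rightarrow> c\<close>. In this form it passes through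
  the series by dominated convergence (Tannery's theorem).
\<close>

lemma limsup_bound_contracts:
  fixes e \<delta> :: "nat \<Rightarrow> nat \<Rightarrow> real" and b :: "nat \<Rightarrow> real"
  assumes b_nonneg: "\<And>j. b j \<ge> 0" and b_summable: "summable b"
    and e_nonneg: "\<And>n k. e n k \<ge> 0"
    and e_le: "\<forall>\<^sub>F n in sequentially. \<forall>k\<ge>1. e n k \<le> C"
    and \<delta>: "\<And>k. k \<ge> 1 \<Longrightarrow> (\<lambda>n. \<delta> n k) \<longlonglongrightarrow> 0"
    and ineq: "\<forall>\<^sub>F n in sequentially. \<forall>k\<ge>1. e n k \<le> \<delta> n k + (\<Sum>j. b j * e n (k * (j + 2)))"
    and bound: "\<And>k. k \<ge> 1 \<Longrightarrow> (\<lambda>n. max c (e n k)) \<longlonglongrightarrow> c"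
    and k: "k \<ge> 1"
  shows "(\<lambda>n. max (suminf b * c) (e n k)) \<longlonglongrightarrow> suminf b * c"
proof (rule tendsto_sandwich)
  show "\<forall>\<^sub>F n in sequentially. suminf b * c \<le> max (suminf b * c) (e n k)"
    by simp
  let ?T = "\<lambda>n. \<Sum>j. b j * max c (e n (k * (j + 2)))"
  have nn: "max c (e n i) \<ge> 0" for n i
    using e_nonneg[of n i] by linarith
  have dom: "\<bar>b j * max c (e n (k * (j + 2)))\<bar> \<le> b j * max c C"
    if "\<forall>k\<ge>1. e n k \<le> C" for n j
  proof -
    have "max c (e n (k * (j + 2))) \<le> max c C"
      using that k by (intro max.mono) auto
    then show ?thesis
      using b_nonneg[of j] nn by (simp add: abs_mult mult_left_mono)
  qed
  have "?T \<longlonglongrightarrow> (\<Sum>j. b j * c)"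
  proof (intro conjunct2[OF conjunct2[OF tannerys_theorem]])
    show "(\<lambda>n. b j * max c (e n (k * (j + 2)))) \<longlonglongrightarrow> b j * c" for j
      using k by (intro tendsto_intros bound) auto
    show "\<forall>\<^sub>F (j, n) in sequentially \<times>\<^sub>F sequentially.
        norm (b j * max c (e n (k * (j + 2)))) \<le> b j * max c C"
      using eventually_prodI[OF always_eventually[of "\<lambda>_. True"] e_le]
      by (rule eventually_mono) (use dom in auto)
    show "summable (\<lambda>j. b j * max c C)"
      using b_summable by (rule summable_mult2)
  qed simp
  then have T: "?T \<longlonglongrightarrow> suminf b * c"
    using suminf_mult2[OF b_summable, of c] by simp
  then show "(\<lambda>n. max (suminf b * c) (\<delta> n k + ?T n)) \<longlonglongrightarrow> suminf b * c"
    using tendsto_max[OF tendsto_const tendsto_add[OF \<delta>[OF k] T], of "suminf b * c"] by simp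
  show "\<forall>\<^sub>F n in sequentially. max (suminf b * c) (e n k) \<le> max (suminf b * c) (\<delta> n k + ?T n)"
    using e_le ineq
  proof eventually_elim
    case (elim n)
    have sT: "summable (\<lambda>j. b j * max c (e n (k * (j + 2))))"
      using dom[OF elim(1)]
      by (intro summable_comparison_test[OF _ summable_mult2[OF b_summable, of "max c C"]])
        (auto intro!: exI[of _ 0])
    have le: "b j * e n (k * (j + 2)) \<le> b j * max c (e n (k * (j + 2)))" for j
      using b_nonneg by (intro mult_left_mono) auto
    have s: "summable (\<lambda>j. b j * e n (k * (j + 2)))"
      using le b_nonneg e_nonneg
      by (intro summable_comparison_test[OF _ sT]) (auto intro!: exI[of _ 0] simp: abs_mult)
    have "(\<Sum>j. b j * e n (k * (j + 2))) \<le> ?T n"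
      using le s sT by (rule suminf_le)
    moreover have "e n k \<le> \<delta> n k + (\<Sum>j. b j * e n (k * (j + 2)))"
      using elim(2) k by blast
    ultimately show ?case
      by (intro max.mono) linarith+
  qed
qed simp

lemma tendsto_zero_by_contraction:
  fixes e \<delta> :: "nat \<Rightarrow> nat \<Rightarrow> real" and b :: "nat \<Rightarrow> real"
  assumes b_nonneg: "\<And>j. b j \<ge> 0" and b_summable: "summable b" and b_less: "suminf b < 1"
    and e_nonneg: "\<And>n k. e n k \<ge> 0"
    and e_le: "\<forall>\<^sub>F n in sequentially. \<forall>k\<ge>1. e n k \<le> C"
    and \<delta>: "\<And>k. k \<ge> 1 \<Longrightarrow> (\<lambda>n. \<delta> n k) \<longlonglongrightarrow> 0"
    and ineq: "\<forall>\<^sub>F n in sequentially. \<forall>k\<ge>1. e n k \<le> \<delta> n k + (\<Sum>j. b j * e n (k * (j + 2)))"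
    and k: "k \<ge> 1"
  shows "(\<lambda>n. e n k) \<longlonglongrightarrow> 0"
proof (rule LIMSEQ_I)
  fix \<epsilon> :: real
  assume \<epsilon>: "\<epsilon> > 0"
  let ?q = "suminf b"
  have q: "0 \<le> ?q"
    using b_summable b_nonneg by (rule suminf_nonneg)
  have iter: "(\<lambda>n. max (?q ^ t * C) (e n k)) \<longlonglongrightarrow> ?q ^ t * C" if "k \<ge> 1" for t k
    using that
  proof (induction t arbitrary: k)
    case 0
    have "\<forall>\<^sub>F n in sequentially. C = max C (e n k)"
      using e_le by eventually_elim (use 0 in \<open>auto simp: max_def intro: antisym\<close>)
    then show ?case
      by (simp add: Lim_transform_eventually[OF tendsto_const])
  next
    case (Suc t)
    show ?case
      using limsup_bound_contracts[OF b_nonneg b_summable e_nonneg e_le \<delta> ineq Suc.IH Suc.prems]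
      by (simp add: mult.assoc)
  qed
  have "(\<lambda>t. ?q ^ t * C) \<longlonglongrightarrow> 0 * C"
    using q b_less by (intro tendsto_intros LIMSEQ_power_zero) auto
  then have "\<forall>\<^sub>F t in sequentially. ?q ^ t * C < \<epsilon>"
    using \<epsilon> by (simp add: order_tendsto_iff)
  then obtain t where t: "?q ^ t * C < \<epsilon>"
    by (auto simp: eventually_sequentially)
  have "\<forall>\<^sub>F n in sequentially. max (?q ^ t * C) (e n k) < \<epsilon>"
    using iter[OF k, of t] t by (simp add: order_tendsto_iff)
  then have "\<forall>\<^sub>F n in sequentially. norm (e n k - 0) < \<epsilon>"
    by eventually_elim (use e_nonneg in auto)
  then show "\<exists>N. \<forall>n\<ge>N. norm (e n k - 0) < \<epsilon>"
    by (simp add: eventually_sequentially)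
qed

section \<open>Divisibility probabilities determine convergence to the Zeta law\<close>

lemma inverse_squares_sums_zeta: "(\<lambda>j. 1 / (real (Suc j))\<^sup>2) sums zeta 2"
proof -
  have "real (Suc j) powr 2 = (real (Suc j))\<^sup>2" for j
    by (subst powr_realpow[symmetric]) auto
  then show ?thesis
    using zeta_sums[of 2] by simp
qed

lemma zeta_2_less_2: "zeta 2 < 2"
proof -
  have "zeta 2 = pi\<^sup>2 / 6"
    using sums_unique2[OF inverse_squares_sums_zeta] inverse_squares_sums
    by (simp add: add.commute)
  moreover have "pi\<^sup>2 \<le> (3.2)\<^sup>2"
    using pi_approx(2) pi_ge_zero by (intro power_mono) simp_all
  ultimately show ?thesis
    by (simp add: power2_eq_square)
qed

lemma inverse_squares_from_2_sums: "(\<lambda>j. 1 / (real (j + 2))\<^sup>2) sums (zeta 2 - 1)"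
  using inverse_squares_sums_zeta
    sums_Suc_iff[of "\<lambda>j. 1 / (real (Suc j))\<^sup>2" "zeta 2 - 1"]
  by simp

lemma prob_multiples_sums:
  fixes P :: "nat measure"
  assumes "prob_space P" and sets: "sets P = UNIV" and zero: "measure P {0} = 0" and k: "k \<ge> 1"
  shows "(\<lambda>j. measure P {k * Suc j}) sums measure P {m. k dvd m}"
proof -
  interpret prob_space P by fact
  have "{m. k dvd m} = (\<Union>j. {k * j})"
    by auto
  moreover have "disjoint_family (\<lambda>j. {k * j})"
    using k by (auto simp: disjoint_family_on_def)
  ultimately have "(\<lambda>j. measure P {k * j}) sums measure P {m. k dvd m}"
    using finite_measure_UNION[of "\<lambda>j. {k * j}"] sets by simp
  then show ?thesis
    using sums_Suc_iff[of "\<lambda>j. measure P {k * j}"] zero by simp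
qed

text \<open>
  The upper bound is uniform in \<open>n\<close>, which supplies the dominating series. For \<open>k = 0\<close> it reads
  \<open>P\<^sub>n({0}) \<le> 1/0 = 0\<close>, so it also says that \<open>P\<^sub>n\<close> is carried by the positive integers.
\<close>

theorem converges_to_zeta_law_2:
  fixes P :: "nat \<Rightarrow> nat measure"
  assumes prob: "\<forall>\<^sub>F n in sequentially. prob_space (P n)"
    and sets: "\<forall>\<^sub>F n in sequentially. sets (P n) = UNIV"
    and le: "\<forall>\<^sub>F n in sequentially. \<forall>k. measure (P n) {m. k dvd m} \<le> 1 / (real k)\<^sup>2"
    and lim: "\<And>k. k \<ge> 1 \<Longrightarrow> (\<lambda>n. measure (P n) {m. k dvd m}) \<longlonglongrightarrow> 1 / (real k)\<^sup>2"
  shows "converges_in_law P (measure_pmf (zeta_law 2))"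
  unfolding converges_in_law_def
proof
  fix k
  define z where "z = zeta 2"
  define c where "c n k = (real k)\<^sup>2 * measure (P n) {k}" for n k
  define d where "d n k = (real k)\<^sup>2 * measure (P n) {m. k dvd m}" for n k
  define b where "b j = 1 / (real (j + 2))\<^sup>2" for j
  have b: "b sums (z - 1)"
    using inverse_squares_from_2_sums by (simp add: b_def[abs_def] z_def)
  have z1: "z \<ge> 1"
    using sums_le[OF _ sums_zero b] by (simp add: b_def)
  have zero: "\<forall>\<^sub>F n in sequentially. measure (P n) {0} = 0"
    using le
  proof eventually_elim
    case (elim n)
    show ?case
      using spec[OF elim, of 0] measure_le_0_iff[of "P n" "{0}"] by simp
  qed
  have c_le: "\<forall>\<^sub>F n in sequentially. \<forall>k. 0 \<le> c n k \<and> c n k \<le> 1"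
    using prob sets le
  proof eventually_elim
    case (elim n)
    interpret prob_space "P n" by fact
    show ?case
    proof
      fix k
      have "measure (P n) {k} \<le> measure (P n) {m. k dvd m}"
        using elim(2) by (intro finite_measure_mono) auto
      also have "\<dots> \<le> 1 / (real k)\<^sup>2"
        using elim(3) by blast
      finally have "(real k)\<^sup>2 * measure (P n) {k} \<le> (real k)\<^sup>2 * (1 / (real k)\<^sup>2)"
        by (rule mult_left_mono) simp
      also have "\<dots> \<le> 1"
        by simp
      finally show "0 \<le> c n k \<and> c n k \<le> 1"
        by (simp add: c_def)
    qed
  qed
  have split: "\<forall>\<^sub>F n in sequentially. \<forall>k\<ge>1. (\<lambda>j. b j * c n (k * (j + 2))) sums (d n k - c n k)"
    using prob sets zero
  proof eventually_elim
    case (elim n)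
    show ?case
    proof (intro allI impI)
      fix k :: nat
      assume k: "k \<ge> 1"
      have "(\<lambda>j. (real k)\<^sup>2 * measure (P n) {k * Suc j}) sums d n k"
        unfolding d_def using prob_multiples_sums[OF elim k] by (rule sums_mult)
      then have "(\<lambda>j. (real k)\<^sup>2 * measure (P n) {k * Suc (Suc j)}) sums (d n k - c n k)"
        using sums_Suc_iff[of "\<lambda>j. (real k)\<^sup>2 * measure (P n) {k * Suc j}" "d n k - c n k"]
        by (simp add: c_def)
      moreover have "(real k)\<^sup>2 * measure (P n) {k * Suc (Suc j)} = b j * c n (k * (j + 2))" for j
      proof -
        have "real (j + 2) \<noteq> 0"
          by simp
        then show ?thesis
          unfolding b_def c_def of_nat_mult power_mult_distrib by simp
      qed
      ultimately show "(\<lambda>j. b j * c n (k * (j + 2))) sums (d n k - c n k)"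
        by simp
    qed
  qed
  have e_le: "\<forall>\<^sub>F n in sequentially. \<forall>k. \<bar>c n k - 1 / z\<bar> \<le> 1"
    using c_le
  proof eventually_elim
    case (elim n)
    have "0 \<le> 1 / z" "1 / z \<le> 1"
      using z1 by simp_all
    then have "\<bar>c n k - 1 / z\<bar> \<le> 1" for k
      using spec[OF elim, of k] by linarith
    then show ?case
      by blast
  qed
  have ineq: "\<forall>\<^sub>F n in sequentially. \<forall>k\<ge>1. \<bar>c n k - 1 / z\<bar>
      \<le> \<bar>d n k - 1\<bar> + (\<Sum>j. b j * \<bar>c n (k * (j + 2)) - 1 / z\<bar>)"
    using split e_le
  proof eventually_elim
    case (elim n)
    show ?case
    proof (intro allI impI)
      fix k :: nat
      assume k: "k \<ge> 1"
      let ?g = "\<lambda>j. b j * (c n (k * (j + 2)) - 1 / z)"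
      have "?g sums (d n k - c n k - (z - 1) * (1 / z))"
        unfolding right_diff_distrib
        using elim(1) k by (intro sums_diff sums_mult2[OF b]) auto
      then have g: "suminf ?g = d n k - c n k - (1 - 1 / z)"
        using z1 by (simp add: sums_iff field_simps)
      have "\<bar>c n i - 1 / z\<bar> \<le> 1" for i
        using elim(2) by blast
      then have "norm (\<bar>?g j\<bar>) \<le> b j" for j
        using mult_left_mono[of "\<bar>c n (k * (j + 2)) - 1 / z\<bar>" 1 "b j"] by (simp add: abs_mult b_def)
      then have "summable (\<lambda>j. \<bar>?g j\<bar>)"
        by (intro summable_comparison_test[OF _ sums_summable[OF b]] exI[of _ 0] allI impI)
      then have "\<bar>suminf ?g\<bar> \<le> (\<Sum>j. \<bar>?g j\<bar>)"
        by (rule summable_rabs)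
      also have "(\<lambda>j. \<bar>?g j\<bar>) = (\<lambda>j. b j * \<bar>c n (k * (j + 2)) - 1 / z\<bar>)"
        by (simp add: abs_mult b_def)
      finally show "\<bar>c n k - 1 / z\<bar> \<le> \<bar>d n k - 1\<bar> + (\<Sum>j. b j * \<bar>c n (k * (j + 2)) - 1 / z\<bar>)"
        unfolding g by linarith
    qed
  qed
  have c_lim: "(\<lambda>n. c n k) \<longlonglongrightarrow> 1 / z" if k: "k \<ge> 1" for k
  proof -
    have "(\<lambda>n. \<bar>c n k - 1 / z\<bar>) \<longlonglongrightarrow> 0"
    proof (rule tendsto_zero_by_contraction[where \<delta> = "\<lambda>n k. \<bar>d n k - 1\<bar>"
          and e = "\<lambda>n k. \<bar>c n k - 1 / z\<bar>" and b = b and C = 1])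
      show "suminf b < 1" "summable b"
        using b zeta_2_less_2 by (auto simp: sums_iff z_def)
      show "\<forall>\<^sub>F n in sequentially. \<forall>k\<ge>1. \<bar>c n k - 1 / z\<bar> \<le> 1"
        using e_le by eventually_elim blast
      show "(\<lambda>n. \<bar>d n k - 1\<bar>) \<longlonglongrightarrow> 0" if "k \<ge> 1" for k
      proof -
        have "(\<lambda>n. d n k) \<longlonglongrightarrow> (real k)\<^sup>2 * (1 / (real k)\<^sup>2)"
          unfolding d_def by (intro tendsto_intros lim that)
        then have "(\<lambda>n. d n k - 1) \<longlonglongrightarrow> 0"
          using that by (simp add: LIM_zero)
        then show ?thesis
          by (rule tendsto_rabs_zero)
      qed
      show "b j \<ge> 0" for j
        by (simp add: b_def)
    qed (fact abs_ge_zero ineq k)+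
    then show ?thesis
      by (simp add: LIM_zero_iff tendsto_rabs_zero_iff)
  qed
  show "(\<lambda>n. measure (P n) {k}) \<longlonglongrightarrow> measure (measure_pmf (zeta_law 2)) {k}"
  proof (cases "k \<ge> 1")
    case False
    then have "k = 0"
      by simp
    moreover have "(\<lambda>n. measure (P n) {0}) \<longlonglongrightarrow> 0"
      using zero by (rule tendsto_eventually)
    ultimately show ?thesis
      by (simp add: measure_pmf_single pmf_zeta_law)
  next
    case True
    then have "real k powr (-2) = 1 / (real k)\<^sup>2"
      by (simp add: powr_minus_divide)
    then have "measure (measure_pmf (zeta_law 2)) {k} = 1 / z / (real k)\<^sup>2"
      using True by (simp add: measure_pmf_single pmf_zeta_law z_def)
    moreover have "measure (P n) {k} = c n k / (real k)\<^sup>2" for n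
      using True by (simp add: c_def)
    ultimately show ?thesis
      using tendsto_divide[OF c_lim[OF True] tendsto_const, of "(real k)\<^sup>2"] True by simp
  qed
qed

section \<open>Divisibility for uniform integers\<close>

lemma card_multiples_upto: "card ({1..n} \<inter> {m. d dvd m}) = n div d"
proof (cases "d = 0")
  case True
  then have "{1..n} \<inter> {m. d dvd m} = {}"
    by auto
  then show ?thesis
    using True by (metis card.empty div_by_0)
next
  case False
  have "{1..n} \<inter> {m. d dvd m} = (*) d ` {1..n div d}"
  proof (intro equalityI subsetI)
    fix m assume m: "m \<in> {1..n} \<inter> {m. d dvd m}"
    then obtain i where i: "m = d * i"
      by auto
    then have "i \<in> {1..n div d}"
      using m False by (auto simp: less_eq_div_iff_mult_less_eq mult.commute)
    then show "m \<in> (*) d ` {1..n div d}"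
      using i by blast
  next
    fix m assume "m \<in> (*) d ` {1..n div d}"
    then show "m \<in> {1..n} \<inter> {m. d dvd m}"
      using False by (auto simp: less_eq_div_iff_mult_less_eq mult.commute)
  qed
  then show ?thesis
    using False by (simp add: card_image inj_on_def)
qed

lemma uniform_prob_dvd:
  assumes "n \<ge> 1"
  shows "measure (measure_pmf (pmf_of_set {1..n})) {m. d dvd m} = real (n div d) / real n"
  using assms by (subst measure_pmf_of_set) (auto simp del: One_nat_def simp: card_multiples_upto)

lemma div_ratio_le: "real (n div d) / real n \<le> 1 / real d"
proof -
  have "real (n div d) \<le> real n / real d"
    using floor_divide_of_nat_eq[of n d, where 'a = real] by linarith
  then have "real (n div d) / real n \<le> real n / real d / real n"
    by (rule divide_right_mono) simp
  also have "\<dots> \<le> 1 / real d"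
    by simp
  finally show ?thesis .
qed

lemma div_ratio_tendsto: "(\<lambda>n. real (n div d) / real n) \<longlonglongrightarrow> 1 / real d"
proof (cases "d = 0")
  case False
  show ?thesis
  proof (rule tendsto_sandwich)
    show "\<forall>\<^sub>F n in sequentially. 1 / real d - 1 / real n \<le> real (n div d) / real n"
      using eventually_gt_at_top[of 0]
    proof eventually_elim
      case (elim n)
      have "real n / real d - 1 \<le> real (n div d)"
        using floor_divide_of_nat_eq[of n d, where 'a = real] by linarith
      then have "(real n / real d - 1) / real n \<le> real (n div d) / real n"
        by (rule divide_right_mono) simp
      then show ?case
        using elim by (simp add: diff_divide_distrib)
    qed
    have "(\<lambda>n. 1 / real d - 1 / real n) \<longlonglongrightarrow> 1 / real d - 0"
      by (intro tendsto_intros lim_1_over_n)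
    then show "(\<lambda>n. 1 / real d - 1 / real n) \<longlonglongrightarrow> 1 / real d"
      by simp
    show "\<forall>\<^sub>F n in sequentially. real (n div d) / real n \<le> 1 / real d"
      by (simp add: div_ratio_le)
  qed simp
qed simp

text \<open>
  The squares dividing \<open>m\<close> are closed under least common multiples, so their largest root is
  divisible by all the others.
\<close>

lemma dvd_largest_square_root_divisor_iff:
  assumes m: "m \<ge> 1"
  shows "k dvd largest_square_root_divisor m \<longleftrightarrow> k\<^sup>2 dvd m"
proof
  let ?S = "{a. a\<^sup>2 dvd m}" and ?r = "largest_square_root_divisor m"
  have fin: "finite ?S"
    using m by (rule finite_square_divisors)
  have "1 \<in> ?S"
    by simp
  then have r: "?r\<^sup>2 dvd m"
    using Max_in[OF fin] unfolding largest_square_root_divisor_def by blast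
  show "k\<^sup>2 dvd m" if "k dvd ?r"
    using that r by (meson dvd_power_same dvd_trans)
  assume k: "k\<^sup>2 dvd m"
  let ?l = "lcm k ?r"
  have pos: "k > 0" "?r > 0"
    using k r m by (auto intro!: Nat.gr0I)
  have "?l\<^sup>2 * (gcd k ?r)\<^sup>2 = k\<^sup>2 * ?r\<^sup>2"
    unfolding power_mult_distrib[symmetric] prod_gcd_lcm_nat[of k] by (simp only: mult.commute)
  also have "\<dots> = lcm (k\<^sup>2) (?r\<^sup>2) * (gcd k ?r)\<^sup>2"
    unfolding prod_gcd_lcm_nat[of "k\<^sup>2"] gcd_exp by (rule mult.commute)
  finally have "?l\<^sup>2 = lcm (k\<^sup>2) (?r\<^sup>2)"
    using pos by simp
  then have "?l\<^sup>2 dvd m"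
    using k r by simp
  then have "?l \<le> ?r"
    using Max_ge[OF fin] unfolding largest_square_root_divisor_def by blast
  then have "?l = ?r"
    using dvd_imp_le[OF dvd_lcm2[of ?r k] lcm_pos_nat[OF pos]] by (rule order_antisym)
  then show "k dvd ?r"
    by (metis dvd_lcm1)
qed

theorem mainTheorem1:
  fixes M :: "nat \<Rightarrow> 'w measure"
    and X Y Z W :: "nat \<Rightarrow> 'w \<Rightarrow> nat"
  assumes prob: "\<And>n. n \<ge> 1 \<Longrightarrow> prob_space (M n)"
    and indep: "\<And>n. n \<ge> 1 \<Longrightarrow>
      prob_space.indep_var (M n) (count_space UNIV) (X n) (count_space UNIV) (Y n)"
    and X_unif: "\<And>n. n \<ge> 1 \<Longrightarrow>
      distr (M n) (count_space UNIV) (X n) = measure_pmf (pmf_of_set {1..n})"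
    and Y_unif: "\<And>n. n \<ge> 1 \<Longrightarrow>
      distr (M n) (count_space UNIV) (Y n) = measure_pmf (pmf_of_set {1..n})"
    and Z_def: "\<And>n \<omega>. n \<ge> 1 \<Longrightarrow> Z n \<omega> = gcd (X n \<omega>) (Y n \<omega>)"
    and W_def: "\<And>n \<omega>. n \<ge> 1 \<Longrightarrow> W n \<omega> = largest_square_root_divisor (X n \<omega>)"
  shows "converges_in_law (\<lambda>n. distr (M n) (count_space UNIV) (W n)) (measure_pmf (zeta_law 2))
       \<and> converges_in_law (\<lambda>n. distr (M n) (count_space UNIV) (Z n)) (measure_pmf (zeta_law 2))"
proof
  let ?U = "count_space UNIV :: nat measure"
  let ?PW = "\<lambda>n. distr (M n) ?U (W n)" and ?PZ = "\<lambda>n. distr (M n) ?U (Z n)"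
  have X_meas: "X n \<in> measurable (M n) ?U" and Y_meas: "Y n \<in> measurable (M n) ?U"
    if "n \<ge> 1" for n
    using prob_space.indep_var_rv1[OF prob indep] prob_space.indep_var_rv2[OF prob indep] that
    by auto
  have W_eq: "W n = largest_square_root_divisor \<circ> X n" if "n \<ge> 1" for n
    using W_def[OF that] by auto
  have W_meas: "W n \<in> measurable (M n) ?U" if "n \<ge> 1" for n
    unfolding W_eq[OF that] using X_meas[OF that] by (rule measurable_comp) simp
  have Z_eq: "Z n = (\<lambda>\<omega>. gcd (X n \<omega>) (Y n \<omega>))" if "n \<ge> 1" for n
    using Z_def[OF that] by auto
  have Z_meas: "Z n \<in> measurable (M n) ?U" if "n \<ge> 1" for n
    unfolding Z_eq[OF that] using X_meas[OF that] Y_meas[OF that] by measurable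
  have W_dvd: "measure (?PW n) {m. k dvd m} = real (n div k\<^sup>2) / real n" if n: "n \<ge> 1" for n k
  proof -
    let ?u = "measure_pmf (pmf_of_set {1..n})"
    have "?PW n = distr ?u ?U largest_square_root_divisor"
      unfolding X_unif[OF n, symmetric] W_eq[OF n]
      using X_meas[OF n] by (intro distr_distr[symmetric]) auto
    then have "measure (?PW n) {m. k dvd m} = measure ?u {m. k dvd largest_square_root_divisor m}"
      by (simp add: measure_distr vimage_def)
    also have "\<dots> = measure ?u {m. k\<^sup>2 dvd m}"
      using n by (intro measure_pmf.finite_measure_eq_AE)
        (auto simp: AE_measure_pmf_iff dvd_largest_square_root_divisor_iff)
    also have "\<dots> = real (n div k\<^sup>2) / real n"
      using n by (rule uniform_prob_dvd)
    finally show ?thesis .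
  qed
  have Z_dvd: "measure (?PZ n) {m. k dvd m} = (real (n div k) / real n)\<^sup>2" if n: "n \<ge> 1" for n k
  proof -
    interpret prob_space "M n"
      using n by (rule prob)
    let ?D = "{m. k dvd m}"
    have "measure (?PZ n) ?D = prob (Z n -` ?D \<inter> space (M n))"
      using Z_meas[OF n] by (simp add: measure_distr)
    also have "Z n -` ?D \<inter> space (M n) = (\<lambda>\<omega>. (X n \<omega>, Y n \<omega>)) -` (?D \<times> ?D) \<inter> space (M n)"
      by (auto simp: Z_eq[OF n])
    also have "prob \<dots> = prob (X n -` ?D \<inter> space (M n)) * prob (Y n -` ?D \<inter> space (M n))"
      using indep[OF n] by (rule indep_varD) auto
    also have "\<dots> = measure (distr (M n) ?U (X n)) ?D * measure (distr (M n) ?U (Y n)) ?D"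
      using X_meas[OF n] Y_meas[OF n] by (simp add: measure_distr)
    also have "\<dots> = (real (n div k) / real n)\<^sup>2"
      unfolding X_unif[OF n] Y_unif[OF n] uniform_prob_dvd[OF n] by (simp add: power2_eq_square)
    finally show ?thesis .
  qed
  have ev: "\<forall>\<^sub>F n in sequentially. n \<ge> (1::nat)"
    by (rule eventually_ge_at_top)
  show "converges_in_law ?PW (measure_pmf (zeta_law 2))"
  proof (rule converges_to_zeta_law_2)
    show "\<forall>\<^sub>F n in sequentially. prob_space (?PW n)"
      using ev by eventually_elim (intro prob_space.prob_space_distr prob W_meas)
    show "\<forall>\<^sub>F n in sequentially. \<forall>k. measure (?PW n) {m. k dvd m} \<le> 1 / (real k)\<^sup>2"
      using ev
    proof eventually_elim
      case (elim n)
      show ?case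
        unfolding W_dvd[OF elim] using div_ratio_le[of n "_\<^sup>2"] by simp
    qed
    show "(\<lambda>n. measure (?PW n) {m. k dvd m}) \<longlonglongrightarrow> 1 / (real k)\<^sup>2" for k
    proof (rule Lim_transform_eventually)
      show "(\<lambda>n. real (n div k\<^sup>2) / real n) \<longlonglongrightarrow> 1 / (real k)\<^sup>2"
        using div_ratio_tendsto[of "k\<^sup>2"] by simp
      show "\<forall>\<^sub>F n in sequentially. real (n div k\<^sup>2) / real n = measure (?PW n) {m. k dvd m}"
        using ev by eventually_elim (simp add: W_dvd)
    qed
  qed simp
  show "converges_in_law ?PZ (measure_pmf (zeta_law 2))"
  proof (rule converges_to_zeta_law_2)
    show "\<forall>\<^sub>F n in sequentially. prob_space (?PZ n)"
      using ev by eventually_elim (intro prob_space.prob_space_distr prob Z_meas)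
    show "\<forall>\<^sub>F n in sequentially. \<forall>k. measure (?PZ n) {m. k dvd m} \<le> 1 / (real k)\<^sup>2"
      using ev
    proof eventually_elim
      case (elim n)
      have "(real (n div k) / real n)\<^sup>2 \<le> (1 / real k)\<^sup>2" for k
        using div_ratio_le by (rule power_mono) simp
      then show ?case
        unfolding Z_dvd[OF elim] by (simp add: power_one_over)
    qed
    show "(\<lambda>n. measure (?PZ n) {m. k dvd m}) \<longlonglongrightarrow> 1 / (real k)\<^sup>2" for k
    proof (rule Lim_transform_eventually)
      show "(\<lambda>n. (real (n div k) / real n)\<^sup>2) \<longlonglongrightarrow> 1 / (real k)\<^sup>2"
        using tendsto_power[OF div_ratio_tendsto[of k], of 2] by (simp add: power_one_over)
      show "\<forall>\<^sub>F n in sequentially. (real (n div k) / real n)\<^sup>2 = measure (?PZ n) {m. k dvd m}"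
        using ev by eventually_elim (simp add: Z_dvd)
    qed
  qed simp
qed

end
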